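(* Let $(M,g)$ be a smooth Riemannian manifold with Levi-Civita connection $\nabla$, and let $\mathcal{D}\subseteq TM$ be a regular distribution. Let $X,Y\in\Gamma(\mathcal{D})$. \begin{enumerate} \item We have $$\mathrm{K}^{\mathcal{D}}(X,Y,X,Y)=\mathrm{K}(X,Y,X,Y)-g(B(X,X),B(Y,Y))+g(B(Y,X),B(X,Y))+g\big(\pi^{\mathcal{D}}(\nabla_{[X,Y]^{\mathcal{D}^{\bot}}}X),Y\big).$$ \item If in addition $\mathrm{K}=0$, then $$\mathrm{K}^{\mathcal{D}}(X,Y,X,Y)=-g(B(X,X),B(Y,Y))+g(B(Y,X),B(X,Y))+g\big(\pi^{\mathcal{D}}(\nabla_{[X,Y]^{\mathcal{D}^{\bot}}}X),Y\big).$$ \end{enumerate}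
   Context: All objects are $\mathcal{C}^\infty$. A regular distribution is a smooth subbundle of $TM$ of constant rank; $\mathcal{D}^{\bot}$ is the $g$-orthogonal complement of $\mathcal{D}$; $\Gamma(\cdot)$ denotes smooth sections; $\pi^{\mathcal{D}},\pi^{\mathcal{D}^{\bot}}$ are the orthogonal projections of $TM$ onto $\mathcal{D}$ and $\mathcal{D}^{\bot}$. For $X,Y\in\Gamma(\mathcal{D})$: $\nabla^{\mathcal{D}}_XY=\pi^{\mathcal{D}}(\nabla_XY)$, $[X,Y]^{\mathcal{D}}=\pi^{\mathcal{D}}([X,Y])$, $[X,Y]^{\mathcal{D}^{\bot}}=\pi^{\mathcal{D}^{\bot}}([X,Y])$, and $B(X,Y)=\pi^{\mathcal{D}^{\bot}}(\nabla_XY)$ (second fundamental form). The curvature tensors are $$\mathrm{K}(X_1,X_2,X_3,X_4)=g(\nabla_{X_1}\nabla_{X_2}X_3-\nabla_{X_2}\nabla_{X_1}X_3-\nabla_{[X_1,X_2]}X_3,X_4),$$ $$\mathrm{K}^{\mathcal{D}}(X_1,X_2,X_3,X_4)=g(\nabla^{\mathcal{D}}_{X_1}\nabla^{\mathcal{D}}_{X_2}X_3-\nabla^{\mathcal{D}}_{X_2}\nabla^{\mathcal{D}}_{X_1}X_3-\nabla^{\mathcal{D}}_{[X_1,X_2]^{\mathcal{D}}}X_3,X_4)$$ for $X_1,\dots,X_4\in\Gamma(\mathcal{D})$. $\mathrm{K}=0$ means that the ambient manifold $(M,g,\nabla)$ has zero curvature tensor. *)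

theory Defs
  imports "HOL-Analysis.Analysis" "HOL-Library.Function_Algebras"
begin

instantiation "fun" :: (type, real_vector) real_vector
begin

definition scaleR_fun :: "real \<Rightarrow> ('a \<Rightarrow> 'b) \<Rightarrow> 'a \<Rightarrow> 'b"
  where "scaleR_fun r f = (\<lambda>x. r *\<^sub>R f x)"

instance
  by standard (auto simp: scaleR_fun_def fun_eq_iff scaleR_add_left scaleR_add_right)

end

text \<open>
  In finite dimension, \<open>C\<^sup>k\<close> on an open set means that all directional derivatives exist and
  are \<open>C\<^sup>k\<^sup>-\<^sup>1\<close>. The set \<open>S\<close> is only ever an open set below.
\<close>

primrec Ck_on :: "nat \<Rightarrow> 'e::real_normed_vector set \<Rightarrow> ('e \<Rightarrow> 'f::real_normed_vector) \<Rightarrow> bool"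
  where
    "Ck_on 0 S f \<longleftrightarrow> continuous_on S f"
  | "Ck_on (Suc k) S f \<longleftrightarrow>
      (\<forall>x\<in>S. f differentiable (at x)) \<and>
      (\<forall>v. Ck_on k S (\<lambda>x. frechet_derivative f (at x) v))"

definition smooth_on :: "'e::real_normed_vector set \<Rightarrow> ('e \<Rightarrow> 'f::real_normed_vector) \<Rightarrow> bool"
  where "smooth_on S f \<longleftrightarrow> (\<forall>k. Ck_on k S f)"

text \<open>
  The manifold is the whole type \<open>'a\<close>, whose topology is Hausdorff and second countable by its
  sort; an atlas is a set of pairs of a chart domain and a chart, not necessarily maximal. The
  model space \<open>'e\<close> is a finite-dimensional normed space and not of class \<open>euclidean_space\<close>, because
  that class excludes dimension 0.
\<close>

type_synonym ('a, 'e) atlas = "('a set \<times> ('a \<Rightarrow> 'e)) set"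

definition smooth_atlas ::
    "('a::{t2_space,second_countable_topology}, 'e::real_normed_vector) atlas \<Rightarrow> bool"
  where "smooth_atlas \<A> \<longleftrightarrow>
    (\<exists>B::'e set. finite B \<and> span B = UNIV) \<and>
    (\<forall>(U, \<phi>)\<in>\<A>. open U \<and> open (\<phi> ` U) \<and> homeomorphism U (\<phi> ` U) \<phi> (inv_into U \<phi>)) \<and>
    (\<Union>(U, \<phi>)\<in>\<A>. U) = UNIV \<and>
    (\<forall>(U, \<phi>)\<in>\<A>. \<forall>(V, \<psi>)\<in>\<A>. smooth_on (\<phi> ` (U \<inter> V)) (\<psi> \<circ> inv_into U \<phi>))"

definition smooth_fun_on ::
    "('a::{t2_space,second_countable_topology}, 'e::real_normed_vector) atlas \<Rightarrow>
     'a set \<Rightarrow> ('a \<Rightarrow> real) \<Rightarrow> bool"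
  where "smooth_fun_on \<A> W f \<longleftrightarrow>
    (\<forall>(U, \<phi>)\<in>\<A>. smooth_on (\<phi> ` (U \<inter> W)) (f \<circ> inv_into U \<phi>))"

definition smooth_funs ::
    "('a::{t2_space,second_countable_topology}, 'e::real_normed_vector) atlas \<Rightarrow> ('a \<Rightarrow> real) set"
  where "smooth_funs \<A> = {f. smooth_fun_on \<A> UNIV f}"

text \<open>
  Tangent vectors at \<open>p\<close> are the derivations at \<open>p\<close> of the algebra of smooth functions. As they
  are represented by functionals on all real functions, they are normalised to vanish on
  non-smooth ones, so that equality of functionals is equality of derivations.
\<close>

type_synonym 'a tangent = "('a \<Rightarrow> real) \<Rightarrow> real"
type_synonym 'a field = "'a \<Rightarrow> 'a tangent"

definition tangent_space ::
    "('a::{t2_space,second_countable_topology}, 'e::real_normed_vector) atlas \<Rightarrow> 'a \<Rightarrow> 'a tangent set"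
  where "tangent_space \<A> p = {v.
    (\<forall>f\<in>smooth_funs \<A>. \<forall>h\<in>smooth_funs \<A>. v (\<lambda>x. f x + h x) = v f + v h) \<and>
    (\<forall>c. \<forall>f\<in>smooth_funs \<A>. v (\<lambda>x. c * f x) = c * v f) \<and>
    (\<forall>f\<in>smooth_funs \<A>. \<forall>h\<in>smooth_funs \<A>. v (\<lambda>x. f x * h x) = f p * v h + h p * v f) \<and>
    (\<forall>f. f \<notin> smooth_funs \<A> \<longrightarrow> v f = 0)}"

text \<open>
  On an open set, testing against global smooth functions suffices: by bump functions every
  local smooth function agrees near a given point with a global one.
\<close>

definition smooth_field_on ::
    "('a::{t2_space,second_countable_topology}, 'e::real_normed_vector) atlas \<Rightarrow>
     'a set \<Rightarrow> 'a field \<Rightarrow> bool"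
  where "smooth_field_on \<A> W X \<longleftrightarrow>
    (\<forall>p\<in>W. X p \<in> tangent_space \<A> p) \<and>
    (\<forall>f\<in>smooth_funs \<A>. smooth_fun_on \<A> W (\<lambda>p. X p f))"

definition fields ::
    "('a::{t2_space,second_countable_topology}, 'e::real_normed_vector) atlas \<Rightarrow> 'a field set"
  where "fields \<A> = {X. smooth_field_on \<A> UNIV X}"

text \<open>
  On a non-smooth \<open>f\<close> both terms are derivatives of a constant function, so the normalisation of
  tangent vectors is preserved.
\<close>

definition lie_bracket :: "'a field \<Rightarrow> 'a field \<Rightarrow> 'a field"
  where "lie_bracket X Y = (\<lambda>p f. X p (\<lambda>q. Y q f) - Y p (\<lambda>q. X q f))"

type_synonym 'a metric = "'a \<Rightarrow> 'a tangent \<Rightarrow> 'a tangent \<Rightarrow> real"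
type_synonym 'a connection = "'a field \<Rightarrow> 'a field \<Rightarrow> 'a field"

text \<open>
  Linearity in the second slot follows by symmetry. Smoothness is that of a tensor field:
  \<open>g(X, Y)\<close> is smooth for local smooth \<open>X\<close>, \<open>Y\<close>.
\<close>

definition riemannian_metric ::
    "('a::{t2_space,second_countable_topology}, 'e::real_normed_vector) atlas \<Rightarrow> 'a metric \<Rightarrow> bool"
  where "riemannian_metric \<A> g \<longleftrightarrow>
    (\<forall>p. \<forall>u\<in>tangent_space \<A> p. \<forall>v\<in>tangent_space \<A> p.
       (\<forall>w\<in>tangent_space \<A> p. g p (u + v) w = g p u w + g p v w) \<and>
       (\<forall>c. g p (c *\<^sub>R u) v = c * g p u v) \<and>
       g p u v = g p v u \<and>
       (u \<noteq> 0 \<longrightarrow> g p u u > 0)) \<and>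
    (\<forall>W X Y. open W \<and> smooth_field_on \<A> W X \<and> smooth_field_on \<A> W Y \<longrightarrow>
       smooth_fun_on \<A> W (\<lambda>p. g p (X p) (Y p)))"

definition affine_connection ::
    "('a::{t2_space,second_countable_topology}, 'e::real_normed_vector) atlas \<Rightarrow> 'a connection \<Rightarrow> bool"
  where "affine_connection \<A> nabla \<longleftrightarrow>
    (\<forall>X\<in>fields \<A>. \<forall>Y\<in>fields \<A>. nabla X Y \<in> fields \<A>) \<and>
    (\<forall>X\<in>fields \<A>. \<forall>Y\<in>fields \<A>. \<forall>Z\<in>fields \<A>.
       nabla (X + Y) Z = nabla X Z + nabla Y Z \<and>
       nabla X (Y + Z) = nabla X Y + nabla X Z) \<and>
    (\<forall>f\<in>smooth_funs \<A>. \<forall>X\<in>fields \<A>. \<forall>Y\<in>fields \<A>.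
       nabla (\<lambda>p. f p *\<^sub>R X p) Y = (\<lambda>p. f p *\<^sub>R nabla X Y p) \<and>
       nabla X (\<lambda>p. f p *\<^sub>R Y p) = (\<lambda>p. X p f *\<^sub>R Y p + f p *\<^sub>R nabla X Y p))"

definition levi_civita ::
    "('a::{t2_space,second_countable_topology}, 'e::real_normed_vector) atlas \<Rightarrow>
     'a metric \<Rightarrow> 'a connection \<Rightarrow> bool"
  where "levi_civita \<A> g nabla \<longleftrightarrow>
    affine_connection \<A> nabla \<and>
    (\<forall>X\<in>fields \<A>. \<forall>Y\<in>fields \<A>. nabla X Y - nabla Y X = lie_bracket X Y) \<and>
    (\<forall>X\<in>fields \<A>. \<forall>Y\<in>fields \<A>. \<forall>Z\<in>fields \<A>. \<forall>p.
       X p (\<lambda>q. g q (Y q) (Z q)) = g p (nabla X Y p) (Z p) + g p (Y p) (nabla X Z p))"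

definition curvature ::
    "'a metric \<Rightarrow> 'a connection \<Rightarrow> 'a field \<Rightarrow> 'a field \<Rightarrow> 'a field \<Rightarrow> 'a field \<Rightarrow> 'a \<Rightarrow> real"
  where "curvature g nabla X1 X2 X3 X4 p =
    g p ((nabla X1 (nabla X2 X3) - nabla X2 (nabla X1 X3) - nabla (lie_bracket X1 X2) X3) p) (X4 p)"

definition zero_curvature ::
    "('a::{t2_space,second_countable_topology}, 'e::real_normed_vector) atlas \<Rightarrow>
     'a metric \<Rightarrow> 'a connection \<Rightarrow> bool"
  where "zero_curvature \<A> g nabla \<longleftrightarrow>
    (\<forall>X1\<in>fields \<A>. \<forall>X2\<in>fields \<A>. \<forall>X3\<in>fields \<A>. \<forall>X4\<in>fields \<A>. \<forall>p.
       curvature g nabla X1 X2 X3 X4 p = 0)"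

type_synonym 'a distribution = "'a \<Rightarrow> 'a tangent set"

definition regular_distribution ::
    "('a::{t2_space,second_countable_topology}, 'e::real_normed_vector) atlas \<Rightarrow>
     'a distribution \<Rightarrow> bool"
  where "regular_distribution \<A> D \<longleftrightarrow>
    (\<exists>k::nat. \<forall>p. \<exists>W e. open W \<and> p \<in> W \<and> (\<forall>i<k. smooth_field_on \<A> W (e i)) \<and>
       (\<forall>q\<in>W. inj_on (\<lambda>i. e i q) {..<k} \<and> independent ((\<lambda>i. e i q) ` {..<k}) \<and>
              span ((\<lambda>i. e i q) ` {..<k}) = D q))"

definition sections ::
    "('a::{t2_space,second_countable_topology}, 'e::real_normed_vector) atlas \<Rightarrow>
     'a distribution \<Rightarrow> 'a field set"
  where "sections \<A> D = {X \<in> fields \<A>. \<forall>p. X p \<in> D p}"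

definition orth_compl ::
    "('a::{t2_space,second_countable_topology}, 'e::real_normed_vector) atlas \<Rightarrow>
     'a metric \<Rightarrow> 'a distribution \<Rightarrow> 'a distribution"
  where "orth_compl \<A> g D = (\<lambda>p. {v \<in> tangent_space \<A> p. \<forall>w\<in>D p. g p v w = 0})"

text \<open>
  Meant for \<open>X p\<close> tangent at \<open>p\<close> and \<open>D p\<close> a finite-dimensional subspace of the tangent space or
  the orthogonal complement of one; then the described \<open>w\<close> exists and is unique.
\<close>

definition orth_proj ::
    "('a::{t2_space,second_countable_topology}, 'e::real_normed_vector) atlas \<Rightarrow>
     'a metric \<Rightarrow> 'a distribution \<Rightarrow> 'a field \<Rightarrow> 'a field"
  where "orth_proj \<A> g D X =
    (\<lambda>p. THE w. w \<in> D p \<and> X p - w \<in> orth_compl \<A> g D p)"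

definition dist_connection ::
    "('a::{t2_space,second_countable_topology}, 'e::real_normed_vector) atlas \<Rightarrow>
     'a metric \<Rightarrow> 'a distribution \<Rightarrow> 'a connection \<Rightarrow> 'a connection"
  where "dist_connection \<A> g D nabla X Y = orth_proj \<A> g D (nabla X Y)"

definition second_fundamental_form ::
    "('a::{t2_space,second_countable_topology}, 'e::real_normed_vector) atlas \<Rightarrow>
     'a metric \<Rightarrow> 'a distribution \<Rightarrow> 'a connection \<Rightarrow> 'a field \<Rightarrow> 'a field \<Rightarrow> 'a field"
  where "second_fundamental_form \<A> g D nabla X Y =
    orth_proj \<A> g (orth_compl \<A> g D) (nabla X Y)"

definition dist_curvature ::
    "('a::{t2_space,second_countable_topology}, 'e::real_normed_vector) atlas \<Rightarrow>
     'a metric \<Rightarrow> 'a distribution \<Rightarrow> 'a connection \<Rightarrow>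
     'a field \<Rightarrow> 'a field \<Rightarrow> 'a field \<Rightarrow> 'a field \<Rightarrow> 'a \<Rightarrow> real"
  where "dist_curvature \<A> g D nabla X1 X2 X3 X4 p =
    (let nablaD = dist_connection \<A> g D nabla in
     g p ((nablaD X1 (nablaD X2 X3) - nablaD X2 (nablaD X1 X3)
           - nablaD (orth_proj \<A> g D (lie_bracket X1 X2)) X3) p) (X4 p))"

end

(* The curvature identity is the Gauss equation. For a section Y of D and fields X, V, the function
   g(pi V, Y) equals g(V, Y); differentiating both along X by metric compatibility gives
   g(nabla_X (pi V), Y) = g(nabla_X V, Y) + g(V - pi V, nabla_X Y),
   and the last term only sees the component of nabla_X Y orthogonal to D. Applied to
   V = nabla_Y X and V = nabla_X X this yields the two terms in B; the last term comes from splitting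
   [X, Y] into its two components. The analytic content is that the projection pi V of a smooth
   field is smooth, which follows from Gram-Schmidt applied to a local frame of D. *)

theory Submission
  imports Defs
begin

section \<open>Smooth functions\<close>

lemma Ck_on_SucI:
  assumes "\<And>x. x \<in> S \<Longrightarrow> (f has_derivative f' x) (at x)"
    and "\<And>v. Ck_on k S (\<lambda>x. frechet_derivative f (at x) v)"
  shows "Ck_on (Suc k) S f"
  using assms by (auto simp: differentiable_def)

text \<open>A derivative at a point depends only on values nearby, so openness of \<open>S\<close>
  carries it from \<open>f\<close> to \<open>h\<close>. The directional derivatives then agree on
  \<open>S\<close> again, and the induction continues with them.\<close>

lemma Ck_on_cong:
  assumes "open S" "\<And>x. x \<in> S \<Longrightarrow> f x = h x" "Ck_on k S f"
  shows "Ck_on k S h"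
  using assms(2,3)
proof (induction k arbitrary: f h)
  case 0
  then show ?case using continuous_on_cong[of S S f h] by simp
next
  case (Suc k)
  have der: "(h has_derivative frechet_derivative f (at x)) (at x)" if "x \<in> S" for x
  proof -
    have "(f has_derivative frechet_derivative f (at x)) (at x)"
      using Suc.prems(2) that by (simp add: frechet_derivative_works[symmetric])
    then show ?thesis
      using has_derivative_transform_within_open[OF _ \<open>open S\<close> that] Suc.prems(1) by blast
  qed
  have "Ck_on k S (\<lambda>x. frechet_derivative h (at x) v)" for v
  proof (rule Suc.IH)
    show "Ck_on k S (\<lambda>x. frechet_derivative f (at x) v)" using Suc.prems(2) by simp
    show "frechet_derivative f (at x) v = frechet_derivative h (at x) v" if "x \<in> S" for x
      using frechet_derivative_at[OF der[OF that]] by simp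
  qed
  then show ?case using der by (intro Ck_on_SucI)
qed

text \<open>By uniqueness of derivatives, any explicit formula \<open>f'\<close> may stand for
  \<open>frechet_derivative\<close>. The closure rules below differentiate by formula and recurse
  through this rule.\<close>

lemma Ck_on_SucI_derivative:
  assumes "open S" "\<And>x. x \<in> S \<Longrightarrow> (f has_derivative f' x) (at x)"
    and "\<And>v. Ck_on k S (\<lambda>x. f' x v)"
  shows "Ck_on (Suc k) S f"
proof (rule Ck_on_SucI[OF assms(2)])
  fix v
  show "Ck_on k S (\<lambda>x. frechet_derivative f (at x) v)"
    by (rule Ck_on_cong[OF \<open>open S\<close> _ assms(3)[of v]])
      (simp add: frechet_derivative_at[OF assms(2), symmetric])
qed

text \<open>The base case is that differentiability implies continuity. The product and inverse
  rules need this because their derivatives still contain undifferentiated factors.\<close>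

lemma Ck_on_SucD: "Ck_on (Suc k) S f \<Longrightarrow> Ck_on k S f"
proof (induction k arbitrary: f)
  case 0
  then show ?case
    by (auto intro!: continuous_at_imp_continuous_on differentiable_imp_continuous_within)
next
  case (Suc k)
  have "\<forall>x\<in>S. f differentiable (at x)"
    using Suc.prems by simp
  moreover have "Ck_on k S (\<lambda>x. frechet_derivative f (at x) v)" for v
    by (rule Suc.IH) (use Suc.prems in simp)
  ultimately show ?case by simp
qed

lemma Ck_on_has_derivative:
  assumes "Ck_on (Suc k) S f" "x \<in> S"
  shows "(f has_derivative frechet_derivative f (at x)) (at x)"
  using assms by (simp add: frechet_derivative_works[symmetric])

lemma Ck_on_derivative: "Ck_on (Suc k) S f \<Longrightarrow> Ck_on k S (\<lambda>x. frechet_derivative f (at x) v)"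
  by simp

lemma Ck_on_const: "open S \<Longrightarrow> Ck_on k S (\<lambda>x. c)"
proof (induction k arbitrary: c)
  case (Suc k)
  then show ?case
    by (intro Ck_on_SucI_derivative[where f' = "\<lambda>x v. 0"]) auto
qed simp

lemma Ck_on_add:
  assumes "open S" "Ck_on k S f" "Ck_on k S h"
  shows "Ck_on k S (\<lambda>x. f x + h x)"
  using assms(2,3)
proof (induction k arbitrary: f h)
  case 0
  then show ?case by (simp add: continuous_on_add)
next
  case (Suc k)
  note der = Ck_on_has_derivative[OF Suc.prems(1)] Ck_on_has_derivative[OF Suc.prems(2)]
  show ?case
    by (rule Ck_on_SucI_derivative[OF \<open>open S\<close> has_derivative_add[OF der]])
      (simp_all add: Suc.IH Ck_on_derivative[OF Suc.prems(1)] Ck_on_derivative[OF Suc.prems(2)])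
qed

lemma Ck_on_mult:
  fixes f h :: "'e::real_normed_vector \<Rightarrow> real"
  assumes "open S" "Ck_on k S f" "Ck_on k S h"
  shows "Ck_on k S (\<lambda>x. f x * h x)"
  using assms(2,3)
proof (induction k arbitrary: f h)
  case 0
  then show ?case by (simp add: continuous_on_mult)
next
  case (Suc k)
  note der = Ck_on_has_derivative[OF Suc.prems(1)] Ck_on_has_derivative[OF Suc.prems(2)]
  show ?case
  proof (rule Ck_on_SucI_derivative[OF \<open>open S\<close> has_derivative_mult[OF der]])
    show "Ck_on k S (\<lambda>x. f x * frechet_derivative h (at x) v + frechet_derivative f (at x) v * h x)"
      for v
      by (intro Ck_on_add \<open>open S\<close> Suc.IH Ck_on_SucD[OF Suc.prems(1)] Ck_on_SucD[OF Suc.prems(2)]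
          Ck_on_derivative[OF Suc.prems(1)] Ck_on_derivative[OF Suc.prems(2)])
  qed
qed

text \<open>The derivative of 1/f is -(1/f) f' (1/f), which contains 1/f again; the induction
  hypothesis supplies it one order lower, and the product rule does the rest.\<close>

lemma Ck_on_inverse:
  fixes f :: "'e::real_normed_vector \<Rightarrow> real"
  assumes "open S" "\<And>x. x \<in> S \<Longrightarrow> f x \<noteq> 0" "Ck_on k S f"
  shows "Ck_on k S (\<lambda>x. inverse (f x))"
  using assms(3)
proof (induction k)
  case 0
  then show ?case using assms(2) by (simp add: continuous_on_inverse)
next
  case (Suc k)
  have inv: "Ck_on k S (\<lambda>x. inverse (f x))"
    by (rule Suc.IH[OF Ck_on_SucD[OF Suc.prems]])
  show ?case
  proof (rule Ck_on_SucI_derivative[OF \<open>open S\<close>])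
    \<comment> \<open>The sign is written as a factor \<open>- 1\<close>, so that the rules for
      products and constants cover the whole formula.\<close>
    show "((\<lambda>x. inverse (f x)) has_derivative
        (\<lambda>v. - 1 * (inverse (f x) * frechet_derivative f (at x) v * inverse (f x)))) (at x)"
      if "x \<in> S" for x
      using Deriv.has_derivative_inverse[OF assms(2)[OF that] Ck_on_has_derivative[OF Suc.prems that]]
      by simp
    show "Ck_on k S (\<lambda>x. - 1 * (inverse (f x) * frechet_derivative f (at x) v * inverse (f x)))" for v
      by (intro Ck_on_mult Ck_on_const \<open>open S\<close> inv Ck_on_derivative[OF Suc.prems])
  qed
qed

lemma Ck_on_subset: "Ck_on k S f \<Longrightarrow> T \<subseteq> S \<Longrightarrow> Ck_on k T f"
proof (induction k arbitrary: f)
  case 0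
  then show ?case by (auto intro: continuous_on_subset)
next
  case (Suc k)
  then show ?case by auto
qed

text \<open>Differentiability at a point does not refer to the set, so the step is pointwise;
  openness of the pieces serves to glue continuity in the base case.\<close>

lemma Ck_on_Union:
  assumes "\<And>T. T \<in> \<T> \<Longrightarrow> open T" "\<And>T. T \<in> \<T> \<Longrightarrow> Ck_on k T f"
  shows "Ck_on k (\<Union>\<T>) f"
  using assms(2)
proof (induction k arbitrary: f)
  case 0
  then show ?case using assms(1) by (auto intro: continuous_on_open_Union)
next
  case (Suc k)
  then show ?case by auto
qed

section \<open>Smooth functions on the manifold, tested in charts\<close>

locale smooth_manifold =
  fixes \<A> :: "('a::{t2_space,second_countable_topology}, 'e::real_normed_vector) atlas"
  assumes atlas: "smooth_atlas \<A>"
begin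

lemma
  assumes "(U, \<phi>) \<in> \<A>"
  shows open_chart_image: "open (\<phi> ` U)"
    and chart_homeomorphism: "homeomorphism U (\<phi> ` U) \<phi> (inv_into U \<phi>)"
  using atlas assms unfolding smooth_atlas_def by blast+

text \<open>A homeomorphism is open onto its image, and that image is open in the model space. This
  supplies the open sets on which the C^k calculus is applied.\<close>

lemma open_chart_image_Int:
  assumes "(U, \<phi>) \<in> \<A>" "open W"
  shows "open (\<phi> ` (U \<inter> W))"
proof -
  have "openin (top_of_set U) (U \<inter> W)" using \<open>open W\<close> by (simp add: openin_open_Int)
  then have "openin (top_of_set (\<phi> ` U)) (\<phi> ` (U \<inter> W))"
    by (rule homeomorphism_imp_open_map[OF chart_homeomorphism[OF assms(1)]])
  then show ?thesis using open_chart_image[OF assms(1)] openin_open_trans by blast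
qed

lemma chart_inverse:
  assumes "(U, \<phi>) \<in> \<A>" "y \<in> \<phi> ` (U \<inter> W)"
  shows "inv_into U \<phi> y \<in> W"
  using chart_homeomorphism[OF assms(1)] assms(2) by (auto simp: homeomorphism_def)

lemma smooth_fun_on_iff:
  "smooth_fun_on \<A> W f \<longleftrightarrow>
    (\<forall>U \<phi> k. (U, \<phi>) \<in> \<A> \<longrightarrow> Ck_on k (\<phi> ` (U \<inter> W)) (\<lambda>y. f (inv_into U \<phi> y)))"
  by (auto simp: smooth_fun_on_def smooth_on_def o_def)

lemma smooth_fun_on_cong:
  assumes "open W" "\<And>p. p \<in> W \<Longrightarrow> f p = h p" "smooth_fun_on \<A> W f"
  shows "smooth_fun_on \<A> W h"
  unfolding smooth_fun_on_iff
proof (intro allI impI)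
  fix U k and \<phi> :: "'a \<Rightarrow> 'e"
  assume U: "(U, \<phi>) \<in> \<A>"
  show "Ck_on k (\<phi> ` (U \<inter> W)) (\<lambda>y. h (inv_into U \<phi> y))"
  proof (rule Ck_on_cong[OF open_chart_image_Int[OF U \<open>open W\<close>]])
    show "f (inv_into U \<phi> y) = h (inv_into U \<phi> y)" if "y \<in> \<phi> ` (U \<inter> W)" for y
      using assms(2) chart_inverse[OF U that] by simp
    show "Ck_on k (\<phi> ` (U \<inter> W)) (\<lambda>y. f (inv_into U \<phi> y))"
      using assms(3) U by (simp add: smooth_fun_on_iff)
  qed
qed

lemma smooth_fun_on_subset:
  assumes "smooth_fun_on \<A> W f" "V \<subseteq> W"
  shows "smooth_fun_on \<A> V f"
  unfolding smooth_fun_on_iff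
proof (intro allI impI)
  fix U k and \<phi> :: "'a \<Rightarrow> 'e"
  assume "(U, \<phi>) \<in> \<A>"
  then have "Ck_on k (\<phi> ` (U \<inter> W)) (\<lambda>y. f (inv_into U \<phi> y))"
    using assms(1) by (simp add: smooth_fun_on_iff)
  then show "Ck_on k (\<phi> ` (U \<inter> V)) (\<lambda>y. f (inv_into U \<phi> y))"
    by (rule Ck_on_subset) (use assms(2) in blast)
qed

lemma smooth_fun_on_const: "open W \<Longrightarrow> smooth_fun_on \<A> W (\<lambda>p. c)"
  by (simp add: smooth_fun_on_iff Ck_on_const open_chart_image_Int)

lemma smooth_fun_on_add:
  "open W \<Longrightarrow> smooth_fun_on \<A> W f \<Longrightarrow> smooth_fun_on \<A> W h \<Longrightarrow> smooth_fun_on \<A> W (\<lambda>p. f p + h p)"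
  by (simp add: smooth_fun_on_iff Ck_on_add open_chart_image_Int)

lemma smooth_fun_on_mult:
  "open W \<Longrightarrow> smooth_fun_on \<A> W f \<Longrightarrow> smooth_fun_on \<A> W h \<Longrightarrow> smooth_fun_on \<A> W (\<lambda>p. f p * h p)"
  by (simp add: smooth_fun_on_iff Ck_on_mult open_chart_image_Int)

lemma smooth_fun_on_inverse:
  assumes "open W" "smooth_fun_on \<A> W f" "\<And>p. p \<in> W \<Longrightarrow> f p \<noteq> 0"
  shows "smooth_fun_on \<A> W (\<lambda>p. inverse (f p))"
  unfolding smooth_fun_on_iff
proof (intro allI impI)
  fix U k and \<phi> :: "'a \<Rightarrow> 'e"
  assume U: "(U, \<phi>) \<in> \<A>"
  show "Ck_on k (\<phi> ` (U \<inter> W)) (\<lambda>y. inverse (f (inv_into U \<phi> y)))"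
    using assms(2) U
    by (intro Ck_on_inverse open_chart_image_Int[OF U \<open>open W\<close>] assms(3) chart_inverse[OF U])
      (simp_all add: smooth_fun_on_iff)
qed

lemma smooth_fun_on_locally:
  assumes "\<And>p. \<exists>W. open W \<and> p \<in> W \<and> smooth_fun_on \<A> W f"
  shows "smooth_fun_on \<A> UNIV f"
  unfolding smooth_fun_on_iff
proof (intro allI impI)
  fix U k and \<phi> :: "'a \<Rightarrow> 'e"
  assume U: "(U, \<phi>) \<in> \<A>"
  obtain W where W: "\<And>p. open (W p)" "\<And>p. p \<in> W p" "\<And>p. smooth_fun_on \<A> (W p) f"
    using assms by metis
  have "Ck_on k (\<Union>(range (\<lambda>p. \<phi> ` (U \<inter> W p)))) (\<lambda>y. f (inv_into U \<phi> y))"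
  proof (rule Ck_on_Union)
    fix T assume "T \<in> range (\<lambda>p. \<phi> ` (U \<inter> W p))"
    then obtain p where "T = \<phi> ` (U \<inter> W p)" by blast
    then show "open T" "Ck_on k T (\<lambda>y. f (inv_into U \<phi> y))"
      using open_chart_image_Int[OF U W(1)] W(3)[of p] U by (simp_all add: smooth_fun_on_iff)
  qed
  moreover have "(\<Union>(range (\<lambda>p. \<phi> ` (U \<inter> W p)))) = \<phi> ` (U \<inter> UNIV)"
    using W(2) by blast
  ultimately show "Ck_on k (\<phi> ` (U \<inter> UNIV)) (\<lambda>y. f (inv_into U \<phi> y))" by simp
qed

section \<open>Tangent vectors and vector fields\<close>

lemma subspace_tangent_space: "subspace (tangent_space \<A> p)"
  unfolding subspace_def
  by (auto simp: tangent_space_def scaleR_fun_def algebra_simps)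

lemma smooth_field_onD:
  assumes "smooth_field_on \<A> W X"
  shows "p \<in> W \<Longrightarrow> X p \<in> tangent_space \<A> p"
    and "f \<in> smooth_funs \<A> \<Longrightarrow> smooth_fun_on \<A> W (\<lambda>p. X p f)"
  using assms by (auto simp: smooth_field_on_def)

lemma smooth_field_on_zero: "open W \<Longrightarrow> smooth_field_on \<A> W (\<lambda>p. 0)"
  using subspace_tangent_space
  by (auto simp: smooth_field_on_def smooth_fun_on_const subspace_0)

lemma smooth_field_on_add:
  assumes "open W" "smooth_field_on \<A> W X" "smooth_field_on \<A> W Y"
  shows "smooth_field_on \<A> W (\<lambda>p. X p + Y p)"
  using assms subspace_tangent_space
  by (auto simp: smooth_field_on_def intro!: smooth_fun_on_add subspace_add)

lemma smooth_field_on_scale: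
  assumes "open W" "smooth_fun_on \<A> W f" "smooth_field_on \<A> W X"
  shows "smooth_field_on \<A> W (\<lambda>p. f p *\<^sub>R X p)"
  unfolding smooth_field_on_def
proof (intro conjI ballI)
  show "f p *\<^sub>R X p \<in> tangent_space \<A> p" if "p \<in> W" for p
    by (rule subspace_scale[OF subspace_tangent_space smooth_field_onD(1)[OF assms(3) that]])
  show "smooth_fun_on \<A> W (\<lambda>p. (f p *\<^sub>R X p) h)" if "h \<in> smooth_funs \<A>" for h
    using smooth_fun_on_mult[OF assms(1,2) smooth_field_onD(2)[OF assms(3) that]]
    by (simp add: scaleR_fun_def)
qed

lemma smooth_field_on_diff:
  assumes "open W" "smooth_field_on \<A> W X" "smooth_field_on \<A> W Y"
  shows "smooth_field_on \<A> W (\<lambda>p. X p - Y p)"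
  using smooth_field_on_add[OF assms(1,2) smooth_field_on_scale[OF assms(1) smooth_fun_on_const assms(3)],
      of "-1"] assms(1)
  by simp

text \<open>Tangency is pointwise and smoothness of each \<open>X p f\<close> is local. This will
  assemble the projected field from local smooth representatives.\<close>

lemma smooth_field_on_locally:
  assumes "\<And>p. \<exists>W Z. open W \<and> p \<in> W \<and> smooth_field_on \<A> W Z \<and> (\<forall>q\<in>W. X q = Z q)"
  shows "X \<in> fields \<A>"
  unfolding fields_def smooth_field_on_def mem_Collect_eq
proof (intro conjI ballI)
  show "X p \<in> tangent_space \<A> p" for p
    using assms[of p] by (auto dest: smooth_field_onD(1))
  show "smooth_fun_on \<A> UNIV (\<lambda>p. X p f)" if "f \<in> smooth_funs \<A>" for f
  proof (rule smooth_fun_on_locally)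
    fix p
    obtain W Z where "open W" "p \<in> W" "smooth_field_on \<A> W Z" "\<forall>q\<in>W. X q = Z q"
      using assms by blast
    then show "\<exists>W. open W \<and> p \<in> W \<and> smooth_fun_on \<A> W (\<lambda>p. X p f)"
      using smooth_fun_on_cong[of W "\<lambda>p. Z p f" "\<lambda>p. X p f"] smooth_field_onD(2) that by auto
  qed
qed

lemma fields_diff:
  assumes "X \<in> fields \<A>" "Y \<in> fields \<A>"
  shows "X - Y \<in> fields \<A>"
  using smooth_field_on_diff[of UNIV X Y] assms by (simp add: fields_def fun_diff_def)

lemma fields_tangent: "X \<in> fields \<A> \<Longrightarrow> X p \<in> tangent_space \<A> p"
  by (simp add: fields_def smooth_field_on_def)

end

section \<open>Orthogonal projections\<close>

locale riemannian_manifold = smooth_manifold \<A>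
  for \<A> :: "('a::{t2_space,second_countable_topology}, 'e::real_normed_vector) atlas" +
  fixes g :: "'a metric"
  assumes metric: "riemannian_metric \<A> g"
begin

section \<open>Bilinear algebra of the metric on single tangent spaces\<close>

lemma metric_sym:
  "u \<in> tangent_space \<A> p \<Longrightarrow> v \<in> tangent_space \<A> p \<Longrightarrow> g p u v = g p v u"
  using metric unfolding riemannian_metric_def by blast

lemma metric_pos: "u \<in> tangent_space \<A> p \<Longrightarrow> u \<noteq> 0 \<Longrightarrow> g p u u > 0"
  using metric unfolding riemannian_metric_def by blast

lemma metric_add_left:
  "u \<in> tangent_space \<A> p \<Longrightarrow> v \<in> tangent_space \<A> p \<Longrightarrow> w \<in> tangent_space \<A> p \<Longrightarrow>
    g p (u + v) w = g p u w + g p v w"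
  using metric unfolding riemannian_metric_def by blast

lemma metric_scale_left:
  "u \<in> tangent_space \<A> p \<Longrightarrow> v \<in> tangent_space \<A> p \<Longrightarrow> g p (c *\<^sub>R u) v = c * g p u v"
  using metric unfolding riemannian_metric_def by blast

lemma metric_diff_left:
  assumes "u \<in> tangent_space \<A> p" "v \<in> tangent_space \<A> p" "w \<in> tangent_space \<A> p"
  shows "g p (u - v) w = g p u w - g p v w"
  using metric_add_left[of "u - v" p v w] subspace_diff[OF subspace_tangent_space assms(1,2)] assms
  by simp

text \<open>Expands both curvatures, each of which pairs a difference of three fields with a tangent
  vector.\<close>

lemma metric_fields_diff_left:
  assumes "U \<in> fields \<A>" "V \<in> fields \<A>" "Z \<in> fields \<A>" "w \<in> tangent_space \<A> p"
  shows "g p ((U - V - Z) p) w = g p (U p) w - g p (V p) w - g p (Z p) w"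
proof -
  have "(U - V - Z) p = (U - V) p - Z p" "(U - V) p = U p - V p"
    by (rule minus_apply)+
  then show ?thesis
    using metric_diff_left fields_tangent fields_diff assms by metis
qed

lemma metric_diff_right:
  assumes "u \<in> tangent_space \<A> p" "v \<in> tangent_space \<A> p" "w \<in> tangent_space \<A> p"
  shows "g p w (u - v) = g p w u - g p w v"
  using metric_diff_left[OF assms] metric_sym subspace_diff[OF subspace_tangent_space assms(1,2)] assms
  by metis

lemma metric_add_right:
  assumes "u \<in> tangent_space \<A> p" "v \<in> tangent_space \<A> p" "w \<in> tangent_space \<A> p"
  shows "g p w (u + v) = g p w u + g p w v"
  using metric_add_left[OF assms] metric_sym subspace_add[OF subspace_tangent_space assms(1,2)] assms
  by metis

lemma metric_scale_right:
  assumes "u \<in> tangent_space \<A> p" "v \<in> tangent_space \<A> p"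
  shows "g p v (c *\<^sub>R u) = c * g p v u"
  using metric_scale_left[OF assms] metric_sym
    subspace_scale[OF subspace_tangent_space assms(1)] assms
  by metis

lemma metric_zero_right: "u \<in> tangent_space \<A> p \<Longrightarrow> g p u 0 = 0"
  using metric_scale_right[of 0 p u 0] subspace_0[OF subspace_tangent_space, of p] by simp

lemma metric_smooth:
  "open W \<Longrightarrow> smooth_field_on \<A> W X \<Longrightarrow> smooth_field_on \<A> W Y \<Longrightarrow>
    smooth_fun_on \<A> W (\<lambda>p. g p (X p) (Y p))"
  using metric unfolding riemannian_metric_def by blast

lemma subspace_orthogonal:
  assumes "u \<in> tangent_space \<A> p"
  shows "subspace {v \<in> tangent_space \<A> p. g p u v = 0}"
  using subspace_tangent_space[of p] assms
  by (auto simp: subspace_def metric_zero_right metric_add_right metric_scale_right)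

lemma span_tangent: "B \<subseteq> tangent_space \<A> p \<Longrightarrow> span B \<subseteq> tangent_space \<A> p"
  by (rule span_minimal[OF _ subspace_tangent_space])

text \<open>The tangent vectors orthogonal to \<open>u\<close> form a subspace, so testing on
  generators, here the frame fields, is enough.\<close>

lemma span_orthogonal:
  assumes "u \<in> tangent_space \<A> p" "B \<subseteq> tangent_space \<A> p" "\<And>v. v \<in> B \<Longrightarrow> g p u v = 0" "w \<in> span B"
  shows "g p u w = 0"
  using span_minimal[OF _ subspace_orthogonal[OF assms(1)], of B] assms by blast

text \<open>Gram-Schmidt by induction on the number of frame fields. \<open>Z\<close> is arbitrary
  because the induction hypothesis projects both \<open>Z\<close> and the new frame field
  \<open>e k\<close>. Independence is stated through predecessors, so that initial segments of the
  frame inherit it.\<close>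

lemma local_projection:
  fixes k :: nat
  assumes "open W" "\<And>i. i < k \<Longrightarrow> smooth_field_on \<A> W (e i)"
    and "\<And>i q. i < k \<Longrightarrow> q \<in> W \<Longrightarrow> e i q \<notin> span ((\<lambda>j. e j q) ` {..<i})"
    and "smooth_field_on \<A> W Z"
  shows "\<exists>P. smooth_field_on \<A> W P \<and>
    (\<forall>q\<in>W. P q \<in> span ((\<lambda>i. e i q) ` {..<k}) \<and> (\<forall>i<k. g q (Z q - P q) (e i q) = 0))"
  using assms(2-4)
proof (induction k arbitrary: Z)
  case 0
  show ?case
    by (intro exI[of _ "\<lambda>p. 0"] conjI ballI smooth_field_on_zero \<open>open W\<close> span_zero) simp
next
  case (Suc k)
  let ?S = "\<lambda>q. span ((\<lambda>i. e i q) ` {..<k})"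
  have IH: "\<exists>P. smooth_field_on \<A> W P \<and>
      (\<forall>q\<in>W. P q \<in> ?S q \<and> (\<forall>i<k. g q (V q - P q) (e i q) = 0))"
    if "smooth_field_on \<A> W V" for V
    by (rule Suc.IH[OF Suc.prems(1,2) that]) simp_all
  obtain P where P: "smooth_field_on \<A> W P" "\<And>q. q \<in> W \<Longrightarrow> P q \<in> ?S q"
    "\<And>q i. q \<in> W \<Longrightarrow> i < k \<Longrightarrow> g q (Z q - P q) (e i q) = 0"
    using IH[OF Suc.prems(3)] by blast
  obtain Q where Q: "smooth_field_on \<A> W Q" "\<And>q. q \<in> W \<Longrightarrow> Q q \<in> ?S q"
    "\<And>q i. q \<in> W \<Longrightarrow> i < k \<Longrightarrow> g q (e k q - Q q) (e i q) = 0"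
    using IH[OF Suc.prems(1)[OF lessI]] by blast
  \<comment> \<open>The part of \<open>e k\<close> orthogonal to the earlier fields; it vanishes
    nowhere on \<open>W\<close>, since \<open>e k q\<close> is outside their span.\<close>
  define n where "n = (\<lambda>q. e k q - Q q)"
  have n: "smooth_field_on \<A> W n"
    unfolding n_def by (intro smooth_field_on_diff \<open>open W\<close> Q(1) Suc.prems(1)) simp
  have n_pos: "g q (n q) (n q) > 0" if "q \<in> W" for q
  proof -
    have "n q \<noteq> 0" using Q(2)[OF that] Suc.prems(2)[of k q] that by (auto simp: n_def)
    then show ?thesis using metric_pos smooth_field_onD(1)[OF n that] by blast
  qed
  \<comment> \<open>The coefficient of the projection of \<open>Z\<close> onto the line spanned by
    \<open>n\<close>; it is smooth because the denominator is positive.\<close>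
  define c where "c = (\<lambda>q. g q (Z q) (n q) * inverse (g q (n q) (n q)))"
  have c: "smooth_fun_on \<A> W c"
    unfolding c_def using n_pos
    by (intro smooth_fun_on_mult smooth_fun_on_inverse metric_smooth \<open>open W\<close> n Suc.prems(3)) force
  define P' where "P' = (\<lambda>q. P q + c q *\<^sub>R n q)"
  have P': "smooth_field_on \<A> W P'"
    unfolding P'_def by (intro smooth_field_on_add smooth_field_on_scale \<open>open W\<close> c n P(1))
  have "P' q \<in> span ((\<lambda>i. e i q) ` {..<Suc k}) \<and> (\<forall>i<Suc k. g q (Z q - P' q) (e i q) = 0)"
    if q: "q \<in> W" for q
  proof
    note T [simp] = smooth_field_onD(1)[OF P(1) q] smooth_field_onD(1)[OF Q(1) q]
      smooth_field_onD(1)[OF n q] smooth_field_onD(1)[OF P' q] smooth_field_onD(1)[OF Suc.prems(3) q]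
    have e [simp]: "e i q \<in> tangent_space \<A> q" if "i < Suc k" for i
      using smooth_field_onD(1)[OF Suc.prems(1) q] that by blast
    note [simp] = subspace_diff[OF subspace_tangent_space] subspace_add[OF subspace_tangent_space]
      subspace_scale[OF subspace_tangent_space] metric_diff_left metric_add_left metric_scale_left
      metric_add_right
    have mono: "?S q \<subseteq> span ((\<lambda>i. e i q) ` {..<Suc k})" by (intro span_mono) auto
    have ek: "e k q \<in> span ((\<lambda>i. e i q) ` {..<Suc k})" by (intro span_base) auto
    show "P' q \<in> span ((\<lambda>i. e i q) ` {..<Suc k})"
      unfolding P'_def n_def
      by (intro span_add span_scale span_diff ek subsetD[OF mono] P(2) Q(2) q)
    have n_low: "g q (n q) (e i q) = 0" if "i < k" for i
      using Q(3)[OF q that] by (simp only: n_def)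
    have low: "g q (Z q - P' q) (e i q) = 0" if "i < k" for i
      using P(3)[OF q that] n_low[OF that] that by (simp add: P'_def less_Suc_eq)
    have sub: "(\<lambda>i. e i q) ` {..<k} \<subseteq> tangent_space \<A> q" by auto
    \<comment> \<open>Orthogonality to \<open>e k = Q + n\<close> is checked on each summand:
      \<open>Q\<close> lies in the span of the earlier fields, and for \<open>n\<close> the term in
      \<open>P\<close> vanishes while \<open>c\<close> cancels the rest.\<close>
    have "g q (Z q - P' q) (Q q) = 0"
      by (rule span_orthogonal[OF _ sub _ Q(2)[OF q]]) (use low in auto)
    moreover have "g q (n q) (P q) = 0"
      by (rule span_orthogonal[OF _ sub _ P(2)[OF q]]) (use n_low in auto)
    then have "g q (Z q - P' q) (n q) = 0"
      using n_pos[OF q] metric_sym[OF T(1,3)] by (simp add: P'_def c_def)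
    moreover have "e k q = Q q + n q" by (simp add: n_def)
    ultimately have "g q (Z q - P' q) (e k q) = 0"
      by (metis T(2-5) metric_add_right subspace_diff[OF subspace_tangent_space] add_0)
    then show "\<forall>i<Suc k. g q (Z q - P' q) (e i q) = 0"
      using low by (auto simp: less_Suc_eq)
  qed
  then show ?case using P' by blast
qed

text \<open>Two candidates differ by a vector of \<open>D p\<close> that is orthogonal to
  \<open>D p\<close>, hence by zero. \<open>D\<close> is arbitrary here, so the rule also covers
  projection onto the orthogonal complement.\<close>

lemma orth_proj_eqI:
  assumes "subspace (D p)" "D p \<subseteq> tangent_space \<A> p" "w \<in> D p" "X p - w \<in> orth_compl \<A> g D p"
  shows "orth_proj \<A> g D X p = w"
  unfolding orth_proj_def
proof (rule the_equality)
  show "w \<in> D p \<and> X p - w \<in> orth_compl \<A> g D p" using assms by blast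
  fix w' assume w': "w' \<in> D p \<and> X p - w' \<in> orth_compl \<A> g D p"
  have d: "w' - w \<in> D p" using w' assms subspace_diff by blast
  have "g p ((X p - w) - (X p - w')) (w' - w) = 0"
    using w' assms d by (subst metric_diff_left) (auto simp: orth_compl_def)
  then have "g p (w' - w) (w' - w) = 0" by (simp add: algebra_simps)
  then show "w' = w" using metric_pos[of "w' - w"] d assms(2) by force
qed

end

section \<open>Smooth orthogonal projection onto a regular distribution\<close>

locale riemannian_distribution = riemannian_manifold \<A> g
  for \<A> :: "('a::{t2_space,second_countable_topology}, 'e::real_normed_vector) atlas"
    and g :: "'a metric" +
  fixes D :: "'a distribution"
  assumes regular: "regular_distribution \<A> D"
begin

abbreviation proj :: "'a field \<Rightarrow> 'a field"
  where "proj \<equiv> orth_proj \<A> g D"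

text \<open>Recasts linear independence of the frame as the predecessor condition that
  \<open>local_projection\<close> uses.\<close>

lemma local_frame:
  obtains W and k :: nat and e where "open W" "p \<in> W" "\<And>i. i < k \<Longrightarrow> smooth_field_on \<A> W (e i)"
    "\<And>i q. i < k \<Longrightarrow> q \<in> W \<Longrightarrow> e i q \<notin> span ((\<lambda>j. e j q) ` {..<i})"
    "\<And>q. q \<in> W \<Longrightarrow> D q = span ((\<lambda>i. e i q) ` {..<k})"
proof -
  obtain k :: nat where "\<forall>p. \<exists>W e. open W \<and> p \<in> W \<and> (\<forall>i<k. smooth_field_on \<A> W (e i)) \<and>
       (\<forall>q\<in>W. inj_on (\<lambda>i. e i q) {..<k} \<and> independent ((\<lambda>i. e i q) ` {..<k}) \<and>
              span ((\<lambda>i. e i q) ` {..<k}) = D q)"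
    using regular unfolding regular_distribution_def by blast
  then obtain W e where We: "open W" "p \<in> W" "\<And>i. i < k \<Longrightarrow> smooth_field_on \<A> W (e i)"
    "\<And>q. q \<in> W \<Longrightarrow> inj_on (\<lambda>i. e i q) {..<k}" "\<And>q. q \<in> W \<Longrightarrow> independent ((\<lambda>i. e i q) ` {..<k})"
    "\<And>q. q \<in> W \<Longrightarrow> D q = span ((\<lambda>i. e i q) ` {..<k})"
    by metis
  have "e i q \<notin> span ((\<lambda>j. e j q) ` {..<i})" if "i < k" "q \<in> W" for i q
  proof
    assume "e i q \<in> span ((\<lambda>j. e j q) ` {..<i})"
    \<comment> \<open>Independence of the image set says nothing about repeated values; injectivity
      of the indexing excludes them.\<close>
    moreover have "(\<lambda>j. e j q) ` {..<i} \<subseteq> (\<lambda>j. e j q) ` {..<k} - {e i q}"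
    proof -
      have "e j q \<noteq> e i q" if "j < i" for j
        using inj_onD[OF We(4)[OF \<open>q \<in> W\<close>], of j i] that \<open>i < k\<close> by auto
      then show ?thesis using \<open>i < k\<close> by fastforce
    qed
    ultimately have "e i q \<in> span ((\<lambda>j. e j q) ` {..<k} - {e i q})"
      using span_mono by blast
    then show False using We(5)[OF that(2)] that(1) by (auto simp: dependent_def)
  qed
  then show ?thesis using that We by blast
qed

lemma subspace_distribution: "subspace (D p)"
  by (metis local_frame subspace_span)

lemma distribution_tangent: "D p \<subseteq> tangent_space \<A> p"
proof -
  obtain W and k :: nat and e where We: "open W" "p \<in> W" "\<And>i. i < k \<Longrightarrow> smooth_field_on \<A> W (e i)"
    "\<And>q. q \<in> W \<Longrightarrow> D q = span ((\<lambda>i. e i q) ` {..<k})"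
    by (metis local_frame)
  show ?thesis
    unfolding We(4)[OF We(2)]
    by (rule span_tangent) (use We(2,3) smooth_field_onD(1) in blast)
qed

lemma subspace_orth_compl: "subspace (orth_compl \<A> g D p)"
proof -
  have "0 \<in> tangent_space \<A> p" using subspace_tangent_space subspace_0 by blast
  then have "g p 0 w = 0" if "w \<in> tangent_space \<A> p" for w
    using metric_zero_right[OF that] metric_sym that by metis
  then show ?thesis
    using subspace_tangent_space[of p] distribution_tangent[of p]
    by (auto simp: subspace_def orth_compl_def metric_add_left metric_scale_left subset_iff)
qed

lemma orth_compl_tangent: "orth_compl \<A> g D p \<subseteq> tangent_space \<A> p"
  by (auto simp: orth_compl_def)

lemma proj_local:
  assumes "V \<in> fields \<A>"
  shows "\<exists>W P. open W \<and> p \<in> W \<and> smooth_field_on \<A> W P \<and>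
    (\<forall>q\<in>W. P q \<in> D q \<and> V q - P q \<in> orth_compl \<A> g D q)"
proof -
  obtain W and k :: nat and e where We: "open W" "p \<in> W" "\<And>i. i < k \<Longrightarrow> smooth_field_on \<A> W (e i)"
    "\<And>i q. i < k \<Longrightarrow> q \<in> W \<Longrightarrow> e i q \<notin> span ((\<lambda>j. e j q) ` {..<i})"
    "\<And>q. q \<in> W \<Longrightarrow> D q = span ((\<lambda>i. e i q) ` {..<k})"
    by (rule local_frame[of p]) blast
  have "smooth_field_on \<A> W V"
    unfolding smooth_field_on_def
  proof (intro conjI ballI)
    show "V q \<in> tangent_space \<A> q" for q using fields_tangent[OF assms] .
    fix f assume "f \<in> smooth_funs \<A>"
    then have "smooth_fun_on \<A> UNIV (\<lambda>q. V q f)"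
      using assms by (simp add: fields_def smooth_field_on_def)
    then show "smooth_fun_on \<A> W (\<lambda>q. V q f)" by (rule smooth_fun_on_subset) simp
  qed
  then obtain P where P: "smooth_field_on \<A> W P"
    "\<And>q. q \<in> W \<Longrightarrow> P q \<in> span ((\<lambda>i. e i q) ` {..<k})"
    "\<And>q i. q \<in> W \<Longrightarrow> i < k \<Longrightarrow> g q (V q - P q) (e i q) = 0"
    using local_projection[OF We(1,3,4)] by metis
  have "V q - P q \<in> orth_compl \<A> g D q" if q: "q \<in> W" for q
  proof -
    have t: "V q - P q \<in> tangent_space \<A> q"
      using subspace_diff[OF subspace_tangent_space] fields_tangent[OF assms]
        smooth_field_onD(1)[OF P(1) q] by blast
    have sub: "(\<lambda>i. e i q) ` {..<k} \<subseteq> tangent_space \<A> q"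
      using smooth_field_onD(1)[OF We(3) q] by blast
    have "g q (V q - P q) w = 0" if "w \<in> D q" for w
      by (rule span_orthogonal[OF t sub]) (use P(3)[OF q] that We(5)[OF q] in auto)
    then show ?thesis using t by (simp add: orth_compl_def)
  qed
  then show ?thesis using We(1,2,5) P(1,2) by blast
qed

text \<open>By uniqueness, every local Gram-Schmidt projection coincides with \<open>proj V\<close>
  on its open set, so the local smooth fields already fit together.\<close>

lemma
  assumes "V \<in> fields \<A>"
  shows proj_in: "proj V p \<in> D p"
    and proj_orth: "V p - proj V p \<in> orth_compl \<A> g D p"
    and proj_fields: "proj V \<in> fields \<A>"
proof -
  have eq: "proj V q = w" if "w \<in> D q" "V q - w \<in> orth_compl \<A> g D q" for q w
    using orth_proj_eqI[of D q w V, OF subspace_distribution distribution_tangent that] .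
  show "proj V p \<in> D p" "V p - proj V p \<in> orth_compl \<A> g D p"
    using proj_local[OF assms, of p] eq by metis+
  show "proj V \<in> fields \<A>"
    by (rule smooth_field_on_locally) (metis proj_local[OF assms] eq)
qed

text \<open>\<open>V - proj V\<close> lies in the orthogonal complement, and what it leaves over,
  \<open>proj V\<close>, lies in the double complement because it lies in \<open>D\<close>. This
  makes the second fundamental form explicit.\<close>

lemma orth_proj_orth_compl:
  assumes "V \<in> fields \<A>"
  shows "orth_proj \<A> g (orth_compl \<A> g D) V = V - proj V"
proof
  fix p
  have "proj V p \<in> tangent_space \<A> p"
    using proj_in[OF assms] distribution_tangent by blast
  moreover have "g p (proj V p) w = 0" if "w \<in> orth_compl \<A> g D p" for w
    using proj_in[OF assms, of p] that metric_sym distribution_tangent[of p]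
    by (auto simp: orth_compl_def)
  ultimately have "proj V p \<in> orth_compl \<A> g (orth_compl \<A> g D) p"
    by (simp add: orth_compl_def[of _ _ "orth_compl \<A> g D"])
  then show "orth_proj \<A> g (orth_compl \<A> g D) V p = (V - proj V) p"
    using proj_orth[OF assms, of p]
    by (intro orth_proj_eqI subspace_orth_compl orth_compl_tangent) simp_all
qed

text \<open>Vectors of \<open>D\<close> do not see the orthogonal component of
  \<open>V\<close>.\<close>

lemma metric_proj:
  assumes "V \<in> fields \<A>" "w \<in> D p"
  shows "g p (proj V p) w = g p (V p) w"
proof -
  have "proj V p \<in> tangent_space \<A> p" "w \<in> tangent_space \<A> p"
    using proj_in[OF assms(1)] assms(2) distribution_tangent by blast+
  moreover have "g p (V p - proj V p) w = 0"
    using proj_orth[OF assms(1), of p] assms(2) by (simp add: orth_compl_def)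
  ultimately show ?thesis using metric_diff_left fields_tangent[OF assms(1)] by simp
qed

lemma metric_orth_components:
  assumes "V \<in> fields \<A>" "Z \<in> fields \<A>"
  shows "g p (V p - proj V p) (Z p) = g p (V p - proj V p) (Z p - proj Z p)"
proof -
  have "proj Z p \<in> tangent_space \<A> p"
    using proj_in[OF assms(2)] distribution_tangent by blast
  moreover have "g p (V p - proj V p) (proj Z p) = 0" "V p - proj V p \<in> tangent_space \<A> p"
    using proj_orth[OF assms(1), of p] proj_in[OF assms(2), of p] by (simp_all add: orth_compl_def)
  ultimately show ?thesis using metric_diff_right fields_tangent[OF assms(2)] by simp
qed

section \<open>The Gauss equation\<close>

context
  fixes nabla :: "'a connection"
  assumes levi_civita: "levi_civita \<A> g nabla"
begin

section \<open>Covariant derivatives and comparison of the two curvatures\<close>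

lemma nabla_fields: "X \<in> fields \<A> \<Longrightarrow> Y \<in> fields \<A> \<Longrightarrow> nabla X Y \<in> fields \<A>"
  using levi_civita unfolding levi_civita_def affine_connection_def by blast

lemma nabla_add_left:
  "X \<in> fields \<A> \<Longrightarrow> Y \<in> fields \<A> \<Longrightarrow> Z \<in> fields \<A> \<Longrightarrow> nabla (X + Y) Z = nabla X Z + nabla Y Z"
  using levi_civita unfolding levi_civita_def affine_connection_def by blast

text \<open>Vanishing torsion writes the bracket as a difference of two covariant derivatives, which
  are fields.\<close>

lemma lie_bracket_fields:
  assumes "X \<in> fields \<A>" "Y \<in> fields \<A>"
  shows "lie_bracket X Y \<in> fields \<A>"
proof -
  have "nabla X Y - nabla Y X = lie_bracket X Y"
    using levi_civita assms unfolding levi_civita_def by blast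
  then show ?thesis using fields_diff[OF nabla_fields nabla_fields] assms by metis
qed

lemma nabla_metric:
  "X \<in> fields \<A> \<Longrightarrow> Y \<in> fields \<A> \<Longrightarrow> Z \<in> fields \<A> \<Longrightarrow>
    X p (\<lambda>q. g q (Y q) (Z q)) = g p (nabla X Y p) (Z p) + g p (Y p) (nabla X Z p)"
  using levi_civita unfolding levi_civita_def by blast

lemma metric_nabla_proj:
  assumes X: "X \<in> fields \<A>" and V: "V \<in> fields \<A>" and Y: "Y \<in> sections \<A> D"
  shows "g p (proj (nabla X (proj V)) p) (Y p) = g p (nabla X V p) (Y p)
    + g p (V p - proj V p) (nabla X Y p - proj (nabla X Y) p)"
proof -
  have Yf: "Y \<in> fields \<A>" and YD: "\<And>q. Y q \<in> D q" using Y by (auto simp: sections_def)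
  note pV = proj_fields[OF V]
  \<comment> \<open>The equality is needed as one of functions on all of the manifold, since
    \<open>X p\<close> is about to differentiate it.\<close>
  have "(\<lambda>q. g q (proj V q) (Y q)) = (\<lambda>q. g q (V q) (Y q))"
    using metric_proj[OF V YD] by blast
  then have "g p (nabla X (proj V) p) (Y p) + g p (proj V p) (nabla X Y p) =
      g p (nabla X V p) (Y p) + g p (V p) (nabla X Y p)"
    using nabla_metric[OF X pV Yf, of p] nabla_metric[OF X V Yf, of p] by simp
  moreover have "g p (V p - proj V p) (nabla X Y p) = g p (V p) (nabla X Y p) - g p (proj V p) (nabla X Y p)"
    by (intro metric_diff_left fields_tangent V pV nabla_fields X Yf)
  ultimately show ?thesis
    using metric_proj[OF nabla_fields[OF X pV] YD, of p]
      metric_orth_components[OF V nabla_fields[OF X Yf], of p]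
    by simp
qed

theorem gauss_equation:
  assumes X: "X \<in> sections \<A> D" and Y: "Y \<in> sections \<A> D"
  defines "B \<equiv> second_fundamental_form \<A> g D nabla"
  shows "dist_curvature \<A> g D nabla X Y X Y p =
    curvature g nabla X Y X Y p - g p (B X X p) (B Y Y p) + g p (B Y X p) (B X Y p)
    + g p (proj (nabla (orth_proj \<A> g (orth_compl \<A> g D) (lie_bracket X Y)) X) p) (Y p)"
proof -
  have f [simp]: "X \<in> fields \<A>" "Y \<in> fields \<A>" and YD: "Y p \<in> D p"
    using X Y by (auto simp: sections_def)
  note [simp] = nabla_fields lie_bracket_fields proj_fields fields_diff
  define L where "L = lie_bracket X Y"
  have L [simp]: "L \<in> fields \<A>" by (simp add: L_def)
  have B: "B Z Z' p = nabla Z Z' p - proj (nabla Z Z') p" if "Z \<in> fields \<A>" "Z' \<in> fields \<A>" for Z Z'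
    using that by (simp add: B_def second_fundamental_form_def orth_proj_orth_compl)
  \<comment> \<open>The bracket is split into its components along \<open>D\<close> and orthogonal
    to it.\<close>
  have "nabla L X = nabla (proj L) X + nabla (L - proj L) X"
    using nabla_add_left[of "proj L" "L - proj L" X] by simp
  then have split: "nabla L X p = nabla (proj L) X p + nabla (L - proj L) X p"
    by (metis plus_fun_apply)
  have "g p (nabla L X p) (Y p) = g p (nabla (proj L) X p) (Y p) + g p (nabla (L - proj L) X p) (Y p)"
    unfolding split by (intro metric_add_left fields_tangent nabla_fields fields_diff proj_fields L f)
  then have bracket: "g p (nabla L X p) (Y p) = g p (proj (nabla (proj L) X) p) (Y p)
      + g p (proj (nabla (L - proj L) X) p) (Y p)"
    by (simp add: metric_proj[OF _ YD])
  have dist: "dist_curvature \<A> g D nabla X Y X Y p =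
      g p (proj (nabla X (proj (nabla Y X))) p) (Y p) - g p (proj (nabla Y (proj (nabla X X))) p) (Y p)
      - g p (proj (nabla (proj L) X) p) (Y p)"
    unfolding dist_curvature_def Let_def dist_connection_def L_def[symmetric]
    by (intro metric_fields_diff_left nabla_fields proj_fields fields_tangent L f)
  have curv: "curvature g nabla X Y X Y p =
      g p (nabla X (nabla Y X) p) (Y p) - g p (nabla Y (nabla X X) p) (Y p) - g p (nabla L X p) (Y p)"
    unfolding curvature_def L_def[symmetric]
    by (intro metric_fields_diff_left nabla_fields proj_fields fields_tangent L f)
  \<comment> \<open>Here \<open>V = nabla Y X\<close>, so the two orthogonal components are
    \<open>B Y X\<close> and \<open>B X Y\<close>. With \<open>V = nabla X X\<close> and
    differentiation along \<open>Y\<close> they become \<open>B X X\<close> and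
    \<open>B Y Y\<close>.\<close>
  have "g p (proj (nabla X (proj (nabla Y X))) p) (Y p) =
      g p (nabla X (nabla Y X) p) (Y p) + g p (B Y X p) (B X Y p)"
    by (simp add: metric_nabla_proj[OF _ _ Y] B)
  moreover have "g p (proj (nabla Y (proj (nabla X X))) p) (Y p) =
      g p (nabla Y (nabla X X) p) (Y p) + g p (B X X p) (B Y Y p)"
    by (simp add: metric_nabla_proj[OF _ _ Y] B)
  \<comment> \<open>\<open>curvature\<close> subtracts the term of the full bracket and
    \<open>dist_curvature\<close> only that of \<open>proj L\<close>; their difference leaves the
    term of \<open>L - proj L\<close> with a positive sign.\<close>
  ultimately show ?thesis
    unfolding dist curv bracket L_def[symmetric] by (simp add: orth_proj_orth_compl)
qed

end

end

theorem corollary27: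
  fixes \<A> :: "('a::{t2_space,second_countable_topology}, 'e::real_normed_vector) atlas"
    and g :: "'a metric"
    and nabla :: "'a connection"
    and D :: "'a distribution"
    and X Y :: "'a field"
  assumes "smooth_atlas \<A>"
    and "riemannian_metric \<A> g"
    and "levi_civita \<A> g nabla"
    and "regular_distribution \<A> D"
    and "X \<in> sections \<A> D"
    and "Y \<in> sections \<A> D"
  defines "B \<equiv> second_fundamental_form \<A> g D nabla"
  shows "(\<forall>p. dist_curvature \<A> g D nabla X Y X Y p =
            curvature g nabla X Y X Y p
            - g p (B X X p) (B Y Y p) + g p (B Y X p) (B X Y p)
            + g p (orth_proj \<A> g D
                    (nabla (orth_proj \<A> g (orth_compl \<A> g D) (lie_bracket X Y)) X) p) (Y p)) \<and>
         (zero_curvature \<A> g nabla \<longrightarrow>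
          (\<forall>p. dist_curvature \<A> g D nabla X Y X Y p =
            - g p (B X X p) (B Y Y p) + g p (B Y X p) (B X Y p)
            + g p (orth_proj \<A> g D
                    (nabla (orth_proj \<A> g (orth_compl \<A> g D) (lie_bracket X Y)) X) p) (Y p)))"
proof -
  interpret riemannian_distribution \<A> g D
    by unfold_locales (use assms in auto)
  have gauss: "dist_curvature \<A> g D nabla X Y X Y p =
      curvature g nabla X Y X Y p - g p (B X X p) (B Y Y p) + g p (B Y X p) (B X Y p)
      + g p (proj (nabla (orth_proj \<A> g (orth_compl \<A> g D) (lie_bracket X Y)) X) p) (Y p)" for p
    unfolding B_def by (rule gauss_equation[OF assms(3,5,6)])
  have "curvature g nabla X Y X Y p = 0" if "zero_curvature \<A> g nabla" for p
    using that assms(5,6) by (simp add: zero_curvature_def sections_def)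
  then show ?thesis using gauss by simp
qed

end
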